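(* Let $f(x)\in \mathbb{Z}[x]$ be a polynomial of degree $d\geq 2$ with positive leading coefficient and having at least two distinct roots over $\overline{\mathbb{Q}}$, let $m\in\mathbb{Z}_{\ge 2}$, and put $F(x)=f(x)^m$. For each $r,s\in\mathbb{Z}_{>0}$ with $s>r$ define $G_{s,r}(x,y)=s\,f(y)-r\,f(x)$. Then there is an integer $\delta_F\geq 2$ such that for all such $r,s$ the polynomial $G_{s,r}(x,y)$ has no irreducible factors over $\mathbb{R}$ of degree less than $\delta_F$, and for every $\varepsilon>0$ the number of lattice points $(a,h)\in\{1,\dots,N\}^2$ that are invisible along $F(x)$ is $O_{F,\varepsilon}(N^{1+1/\delta_F+\varepsilon})$.
   Context: For $F(x)\in\mathbb{Z}[x]$ with positive leading coefficient, a lattice point $(a,h)\in\mathbb{Z}_{>0}\times\mathbb{Z}_{>0}$ is called visible along $F(x)$ if there exists a rational number $t\in\mathbb{Q}$ such that $h=t\,F(a)$ and $a$ is the smallest positive integer $u$ such that $t\,F(u)$ is a positive integer; otherwise it is called invisible along $F(x)$. *)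

theory Defs
  imports "HOL-Computational_Algebra.Computational_Algebra" "HOL-Library.Landau_Symbols"
    Complex_Main
begin

definition visible_along :: "int poly \<Rightarrow> int \<times> int \<Rightarrow> bool" where
  "visible_along F = (\<lambda>(a, h). 0 < a \<and> 0 < h \<and>
     (\<exists>t::rat. of_int h = t * of_int (poly F a) \<and>
        (let U = {u::int. 0 < u \<and> t * of_int (poly F u) \<in> \<int> \<and> 0 < t * of_int (poly F u)}
         in a \<in> U \<and> (\<forall>u\<in>U. a \<le> u))))"

definition invisible_along :: "int poly \<Rightarrow> int \<times> int \<Rightarrow> bool" where
  "invisible_along F = (\<lambda>(a, h). 0 < a \<and> 0 < h \<and> \<not> visible_along F (a, h))"

text \<open>
  Bivariate polynomials in \<open>x\<close> and \<open>y\<close> over the reals are represented as polynomials in \<open>y\<close>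
  (outer variable) with coefficients in the ring of real polynomials in \<open>x\<close> (inner variable).
\<close>

definition total_degree :: "'a::zero poly poly \<Rightarrow> nat" where
  "total_degree p = Max (insert 0 {i + j | i j. coeff (coeff p j) i \<noteq> 0})"

definition G_poly :: "int poly \<Rightarrow> int \<Rightarrow> int \<Rightarrow> real poly poly" where
  "G_poly f s r = of_int s * map_poly (\<lambda>c. [:of_int c:]) f - of_int r * [:map_poly of_int f:]"

lemma finite_total_degree_set: "finite {i + j | i j. coeff (coeff p j) i \<noteq> 0}"
proof -
  have "{i + j | i j. coeff (coeff p j) i \<noteq> 0}
      \<subseteq> (\<Union>j\<in>{..degree p}. \<Union>i\<in>{..degree (coeff p j)}. {i + j})"
    by (force intro: le_degree)
  then show ?thesis
    by (rule finite_subset) auto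
qed

lemma poly_G_poly:
  "poly (poly (G_poly f s r) [:of_int v:]) (of_int u)
     = of_int (s * poly f v - r * poly f u)"
proof -
  have 1: "poly (map_poly (\<lambda>c. [:of_int c:]) f) [:of_int v:] = [:of_int (poly f v) :: real:]"
    by (induction f) (simp_all add: map_poly_pCons)
  have 2: "poly (map_poly of_int f) (of_int u) = (of_int (poly f u) :: real)"
    by (induction f) (simp_all add: map_poly_pCons)
  show ?thesis
    by (simp add: G_poly_def 1 2)
qed

end

theory Submission
  imports Defs "HOL-Real_Asymp.Real_Asymp"
begin

text \<open>
  The choice $\delta_F = 2$ works. A linear factor of $s f(y) - r f(x)$ gives an identity
  $s f(cx + t) = r f(x)$ with $0 < |c| < 1$; then $x \mapsto cx + t$ permutes the complex roots of
  $f$, which is impossible for a contraction unless there is only one root.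

  If $(a,h)$ is invisible with $a > \sqrt N$ large, there is $u < a$ such that $f(u)/f(a) = r/s$ in
  lowest terms and $s^m \mid h$, so $s^2 \mid h$. The curve $s f(y) = r f(x)$ is so close to its
  asymptote, with error $O(1/y)$, that its lattice points with $x$ in a short block of length about
  $(r/s) \sqrt N$ are collinear, hence at most $d$ in number by the absence of linear factors. This
  gives $O(\sqrt N\, s/r)$ values of $a$ and at most $N/s^2$ values of $h$ for each pair $(r,s)$,
  and summing over $r, s \le N$ yields $O(N^{3/2} \log^2 N)$.
\<close>

section \<open>Affine self-similarities of a polynomial and its root set\<close>

lemma poly_map_poly_of_int_of_real:
  "poly (map_poly of_int f) (of_real x :: 'a :: {comm_ring_1, real_algebra_1})
     = of_real (poly (map_poly of_int f) x)"
  by (induction f) (simp_all add: map_poly_pCons)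

lemma poly_map_poly_of_int_of_int:
  "poly (map_poly of_int f) (of_int x :: 'a :: comm_ring_1) = of_int (poly f x)"
  by (induction f) (simp_all add: map_poly_pCons)

text \<open>A pair of points of \<open>Z\<close> at maximal positive distance would be sent by
  \<open>T\<close> to a pair in \<open>Z\<close> that is even farther apart.\<close>

lemma expanding_self_map_subsingleton:
  fixes Z :: "'a :: metric_space set"
  assumes "finite Z" "\<And>z. z \<in> Z \<Longrightarrow> T z \<in> Z"
    and T: "\<And>z w. z \<noteq> w \<Longrightarrow> dist (T z) (T w) > dist z w"
    and "z \<in> Z" "w \<in> Z"
  shows "z = w"
proof (rule ccontr)
  assume "z \<noteq> w"
  define D where "D = (\<lambda>(z, w). dist z w) ` (Z \<times> Z)"
  have D: "finite D" "D \<noteq> {}"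
    using assms by (auto simp: D_def)
  then have "Max D \<in> D"
    by (rule Max_in)
  then obtain z' w' where zw': "z' \<in> Z" "w' \<in> Z" "Max D = dist z' w'"
    by (auto simp: D_def)
  have "dist z w \<in> D"
    using assms by (force simp: D_def)
  then have "dist z w \<le> dist z' w'"
    using D zw' by (metis Max_ge)
  then have "z' \<noteq> w'"
    using \<open>z \<noteq> w\<close> by auto
  moreover have "dist (T z') (T w') \<in> D"
    using assms zw' by (force simp: D_def)
  then have "dist (T z') (T w') \<le> dist z' w'"
    using D zw' by (metis Max_ge)
  ultimately show False
    using T by fastforce
qed

text \<open>
  On the level of roots, the identity $s f(cx + t) = r f(x)$ says that the affine contraction
  $x \mapsto cx + t$ and its inverse preserve the finite set of complex roots of $f$.
\<close>

lemma no_affine_self_similarity: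
  fixes f :: "int poly" and c t :: real and r s :: int and B :: "real set"
  assumes deg: "degree f > 0"
    and z: "poly (map_poly of_int f) (z\<^sub>1::complex) = 0" "poly (map_poly of_int f) z\<^sub>2 = 0" "z\<^sub>1 \<noteq> z\<^sub>2"
    and rs: "0 < r" "r < s"
    and B: "finite B" "card B > degree f"
    and eq: "\<And>x. x \<in> B \<Longrightarrow> of_int s * poly (map_poly of_int f) (c * x + t)
                             = of_int r * poly (map_poly of_int f) x"
  shows False
proof -
  define p :: "complex poly" where "p = map_poly of_int f"
  define l :: "complex poly" where "l = [:of_real t, of_real c:]"
  define q where "q = smult (of_int s) (pcompose p l) - smult (of_int r) p"
  have degp: "degree p = degree f"
    by (simp add: p_def degree_map_poly)
  have degq: "degree q \<le> degree f"
  proof -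
    have "degree (pcompose p l) \<le> degree f * 1"
      unfolding degree_pcompose degp by (intro mult_left_mono) (auto simp: l_def)
    then show ?thesis
      unfolding q_def using degp by (intro degree_diff_le) (auto intro: order.trans[OF degree_smult_le])
  qed
  have root: "poly q (of_real x) = 0" if "x \<in> B" for x
  proof -
    have "poly p (of_real t + of_real x * of_real c)
            = complex_of_real (poly (map_poly of_int f) (c * x + t))"
      unfolding p_def poly_map_poly_of_int_of_real[symmetric] by (simp add: algebra_simps)
    moreover have "poly p (of_real x) = complex_of_real (poly (map_poly of_int f) x)"
      unfolding p_def poly_map_poly_of_int_of_real ..
    moreover have "complex_of_int s * complex_of_real (poly (map_poly of_int f) (c * x + t))
                     = complex_of_int r * complex_of_real (poly (map_poly of_int f) x)"
      using arg_cong[OF eq[OF that], of complex_of_real] by simp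
    ultimately show ?thesis
      by (simp add: q_def poly_pcompose l_def)
  qed
  \<comment> \<open>\<open>q\<close> has more than \<open>degree f\<close> zeros, namely the points
    of \<open>B\<close>, so the relation on \<open>B\<close> becomes a polynomial identity that can
    be evaluated at complex roots.\<close>
  have "q = 0"
  proof (rule ccontr)
    assume "q \<noteq> 0"
    have "card B = card (complex_of_real ` B)"
      by (simp add: card_image inj_on_def)
    also have "\<dots> \<le> card {x. poly q x = 0}"
      using root \<open>q \<noteq> 0\<close> by (intro card_mono poly_roots_finite) auto
    also have "\<dots> \<le> degree q"
      by (rule card_poly_roots_bound) fact
    finally show False
      using degq B by simp
  qed
  then have pq: "smult (of_int s) (pcompose p l) = smult (of_int r) p"
    by (simp add: q_def)
  have "c \<noteq> 0"
  proof
    assume "c = 0"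
    then have "degree (smult (of_int s) (pcompose p l)) = 0"
      by (simp add: degree_pcompose l_def)
    then show False
      using rs deg degp by (simp add: pq)
  qed
  \<comment> \<open>Comparing leading coefficients gives s * c ^ degree f = r in absolute value, and
    r < s then forces |c| < 1.\<close>
  then have "lead_coeff (smult (of_int s) (pcompose p l)) = of_int s * (lead_coeff p * of_real c ^ degree f)"
    unfolding lead_coeff_smult by (subst lead_coeff_comp) (auto simp: l_def degp)
  then have "of_int s * (lead_coeff p * of_real c ^ degree f) = of_int r * lead_coeff p"
    unfolding pq lead_coeff_smult by auto
  moreover have "lead_coeff p \<noteq> 0"
    using deg degp by (metis degree_0 leading_coeff_0_iff less_irrefl)
  ultimately have "complex_of_int s * of_real c ^ degree f = of_int r"
    by auto
  then have "norm (complex_of_int s * of_real c ^ degree f) = norm (complex_of_int r)"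
    by simp
  then have "real_of_int s * \<bar>c\<bar> ^ degree f = of_int r"
    using rs by (simp add: norm_mult norm_power)
  moreover have "\<bar>c\<bar> < 1"
  proof (rule ccontr)
    assume "\<not> \<bar>c\<bar> < 1"
    then have "1 \<le> \<bar>c\<bar> ^ degree f"
      by (simp add: one_le_power)
    then have "real_of_int s * 1 \<le> real_of_int s * \<bar>c\<bar> ^ degree f"
      using rs by (intro mult_left_mono) auto
    with calculation rs show False
      by simp
  qed
  ultimately have c: "\<bar>c\<bar> < 1" "c \<noteq> 0"
    using \<open>c \<noteq> 0\<close> by auto
  \<comment> \<open>\<open>T\<close> inverts x -> c x + t and stretches distances by 1/|c|. It maps
    roots to roots because r p(T z) = s p(z).\<close>
  define T where "T = (\<lambda>z::complex. (z - of_real t) / of_real c)"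
  have "z\<^sub>1 = z\<^sub>2"
  proof (rule expanding_self_map_subsingleton[of "{z. poly p z = 0}" T])
    show "finite {z. poly p z = 0}"
      using deg degp by (intro poly_roots_finite) auto
    show "T z \<in> {z. poly p z = 0}" if "z \<in> {z. poly p z = 0}" for z
    proof -
      have "poly (smult (of_int s) (pcompose p l)) (T z) = of_int s * poly p z"
        using c by (simp add: T_def l_def poly_pcompose)
      then show ?thesis
        using that rs by (simp add: pq)
    qed
    show "dist (T z) (T w) > dist z w" if "z \<noteq> w" for z w
    proof -
      have "T z - T w = (z - w) / of_real c"
        by (simp add: T_def diff_divide_distrib)
      then have "dist (T z) (T w) = dist z w / \<bar>c\<bar>"
        by (simp add: dist_norm norm_divide)
      then show ?thesis
        using that c divide_strict_left_mono[of "\<bar>c\<bar>" 1 "dist z w"] by simp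
    qed
  qed (use z in \<open>auto simp: p_def\<close>)
  with z show False
    by simp
qed

section \<open>Factors of \<open>G_poly\<close> of small total degree\<close>

lemma poly_G_poly_real:
  "poly (poly (G_poly f s r) [:v:]) u
     = of_int s * poly (map_poly of_int f) v - of_int r * poly (map_poly of_int f) u"
proof -
  have "poly (map_poly (\<lambda>c. [:of_int c:]) f) [:v:] = [:poly (map_poly of_int f) v :: real:]"
    by (induction f) (simp_all add: map_poly_pCons)
  then show ?thesis
    by (simp add: G_poly_def)
qed

lemma total_degree_ge:
  assumes "coeff (coeff p j) i \<noteq> 0"
  shows "i + j \<le> total_degree p"
  unfolding total_degree_def using assms finite_total_degree_set[of p] by (intro Max_ge) auto

lemma total_degree_less_2E:
  fixes p :: "real poly poly"
  assumes "total_degree p < 2"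
  obtains a b c where "p = [:[:c, a:], [:b:]:]"
proof
  have 0: "coeff (coeff p j) i = 0" if "i + j \<ge> 2" for i j
    using total_degree_ge[of p j i] that assms by linarith
  show "p = [:[:coeff (coeff p 0) 0, coeff (coeff p 0) 1:], [:coeff (coeff p 1) 0:]:]"
    by (intro poly_eqI) (auto simp: coeff_pCons 0 split: nat.splits)
qed

text \<open>Such a factor has the form c + a x + b y, and \<open>G_poly f s r\<close> vanishes on
  its zero set. If b is nonzero, solving for y yields an affine self-similarity of f. If only a is
  nonzero, fixing x = -c/a leaves y free and makes f constant. Otherwise the factor is a constant,
  hence zero or a unit.\<close>

lemma no_factor_of_total_degree_less_2:
  fixes f :: "int poly" and p :: "real poly poly"
  assumes deg: "degree f > 0"
    and z: "poly (map_poly of_int f) (z\<^sub>1::complex) = 0" "poly (map_poly of_int f) z\<^sub>2 = 0" "z\<^sub>1 \<noteq> z\<^sub>2"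
    and rs: "0 < r" "r < s"
    and p: "irreducible p" "p dvd G_poly f s r"
  shows "total_degree p \<ge> 2"
proof (rule ccontr)
  assume "\<not> total_degree p \<ge> 2"
  then obtain a b c where abc: "p = [:[:c, a:], [:b:]:]"
    by (meson not_le total_degree_less_2E)
  have zero: "of_int s * poly (map_poly of_int f) v = of_int r * poly (map_poly of_int f) u"
    if "c + a * u + b * v = 0" for u v :: real
  proof -
    obtain q where q: "G_poly f s r = p * q"
      using p by (elim dvdE)
    have "poly (poly p [:v:]) u = 0"
      using that by (simp add: abc algebra_simps)
    then have "poly (poly (G_poly f s r) [:v:]) u = 0"
      by (simp add: q)
    then show ?thesis
      by (simp add: poly_G_poly_real)
  qed
  consider "b \<noteq> 0" | "b = 0" "a \<noteq> 0" | "b = 0" "a = 0"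
    by blast
  then show False
  proof cases
    case 1
    \<comment> \<open>The relation holds at every real x, so any \<open>degree f + 1\<close> points
      will do.\<close>
    obtain B :: "real set" where "finite B" "card B = degree f + 1"
      using infinite_arbitrarily_large[OF infinite_UNIV_char_0] by blast
    with 1 show False
      using zero by (intro no_affine_self_similarity[OF deg z rs, of B "- a / b" "- c / b"])
        (auto simp: field_simps)
  next
    case 2
    define q where "q = smult (of_int s) (map_poly of_int f) - [:of_int r * poly (map_poly of_int f) (- c / a) :: real:]"
    have "poly q v = 0" for v
      using zero[of "- c / a" v] 2 by (simp add: q_def)
    then have "q = 0"
      using poly_all_0_iff_0 by blast
    then have "smult (of_int s) (map_poly of_int f) = [:of_int r * poly (map_poly of_int f) (- c / a) :: real:]"
      by (simp add: q_def)
    then have "degree (smult (of_int s) (map_poly of_int f) :: real poly) = 0"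
      by simp
    then show False
      using rs deg by (simp add: degree_map_poly)
  next
    case 3
    then have "p = [:[:c:]:]"
      by (simp add: abc)
    moreover have "c \<noteq> 0"
      using p calculation by auto
    ultimately have "p dvd 1"
      by (intro dvdI[of _ _ "[:[:1/c:]:]"]) (simp add: one_pCons)
    then show False
      using p irreducible_not_unit by blast
  qed
qed

section \<open>Growth of real polynomials and the shape of their level curves\<close>

text \<open>With A the leading coefficient and d the degree, p - (A/2) x^d and 2 A x^d - p have
  leading coefficients A/2 and A, so both are eventually nonnegative.\<close>

lemma poly_eventually_between_multiples_of_lead_term:
  fixes p :: "real poly"
  assumes "lead_coeff p > 0"
  shows "\<forall>\<^sub>F x in at_top. lead_coeff p / 2 * x ^ degree p \<le> poly p x
           \<and> poly p x \<le> 2 * lead_coeff p * x ^ degree p"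
proof -
  define A where "A = lead_coeff p"
  have A: "A > 0"
    using assms by (simp add: A_def)
  have ev: "\<forall>\<^sub>F x in at_top. 0 \<le> poly q x" if q: "degree q \<le> degree p" "coeff q (degree p) > 0"
    for q :: "real poly"
  proof -
    have "degree q = degree p"
      using q by (simp add: antisym le_degree)
    then have "lead_coeff q > 0"
      using q by simp
    then show ?thesis
      using poly_pinfty_gt_lc[of q] unfolding eventually_at_top_linorder by (meson less_imp_le order.trans)
  qed
  have "\<forall>\<^sub>F x in at_top. 0 \<le> poly (p - monom (A / 2) (degree p)) x"
    using A by (intro ev degree_diff_le degree_monom_le) (auto simp: A_def)
  moreover have "\<forall>\<^sub>F x in at_top. 0 \<le> poly (monom (2 * A) (degree p) - p) x"
    using A by (intro ev degree_diff_le degree_monom_le) (auto simp: A_def)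
  ultimately show ?thesis
    by eventually_elim (simp add: poly_monom A_def)
qed

lemma abs_poly_le_power:
  fixes q :: "real poly"
  assumes "degree q \<le> n" "x \<ge> 1"
  shows "\<bar>poly q x\<bar> \<le> (\<Sum>i\<le>degree q. \<bar>coeff q i\<bar>) * x ^ n"
proof -
  have "\<bar>poly q x\<bar> \<le> (\<Sum>i\<le>degree q. \<bar>coeff q i * x ^ i\<bar>)"
    unfolding poly_altdef by (rule sum_abs)
  also have "\<dots> \<le> (\<Sum>i\<le>degree q. \<bar>coeff q i\<bar> * x ^ n)"
    using assms by (intro sum_mono) (auto simp: abs_mult intro!: mult_left_mono power_increasing)
  finally show ?thesis
    by (simp add: sum_distrib_right)
qed

text \<open>The shift \<open>b\<close> is chosen so that d A b equals the coefficient of x^(d-1),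
  which cancels along with the leading one. Losing two degrees instead of one is what later makes
  the error O(1/y) rather than O(1).\<close>

lemma complete_the_power:
  fixes p :: "real poly"
  assumes "degree p = d" "d \<ge> 2"
  obtains b q where "degree q \<le> d - 2" "\<And>x. poly p x = lead_coeff p * (x + b) ^ d + poly q x"
proof
  define A where "A = lead_coeff p"
  define b where "b = coeff p (d - 1) / (of_nat d * A)"
  define q where "q = p - smult A ([:b, 1:] ^ d)"
  have "A \<noteq> 0"
    using assms by (auto simp: A_def)
  show "poly p x = lead_coeff p * (x + b) ^ d + poly q x" for x
    by (simp add: q_def A_def add.commute)
  have "coeff q i = 0" if "i > d - 2" for i
  proof -
    have "i > d \<or> i = d \<or> i = d - 1"
      using that by arith
    then consider "i > d" | "i = d" | "i = d - 1"
      by blast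
    then show ?thesis
    proof cases
      case 1
      then have "coeff ([:b, 1:] ^ d) i = 0"
        by (intro coeff_eq_0) (simp add: degree_linear_power)
      then show ?thesis
        using assms 1 by (simp add: q_def coeff_eq_0)
    next
      case 2
      then show ?thesis
        using assms by (simp add: q_def A_def coeff_linear_power)
    next
      case 3
      have "d choose (d - 1) = d"
        using assms binomial_symmetric[of 1 d] by simp
      then show ?thesis
        using assms \<open>A \<noteq> 0\<close> 3 by (simp add: q_def coeff_linear_poly_power b_def)
    qed
  qed
  then show "degree q \<le> d - 2"
    by (intro degree_le) auto
qed

text \<open>In the factorization of y^d - z^d by y - z, the cofactor is a sum of nonnegative terms,
  one of which is y^(d-1).\<close>

lemma abs_diff_power_ge:
  fixes y z :: real
  assumes "y \<ge> 0" "z \<ge> 0" "d > 0"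
  shows "\<bar>y - z\<bar> * y ^ (d - 1) \<le> \<bar>y ^ d - z ^ d\<bar>"
proof -
  obtain n where n: "d = Suc n"
    using assms by (cases d) auto
  have "y ^ n * z ^ (n - n) \<le> (\<Sum>i\<in>{..n}. y ^ i * z ^ (n - i))"
    using assms by (intro member_le_sum[of n "{..n}" "\<lambda>i. y ^ i * z ^ (n - i)"]) auto
  then have "y ^ n \<le> (\<Sum>i<Suc n. y ^ i * z ^ (n - i))"
    by (simp add: lessThan_Suc_atMost)
  then have "\<bar>y - z\<bar> * y ^ n \<le> \<bar>y - z\<bar> * \<bar>\<Sum>i<Suc n. y ^ i * z ^ (n - i)\<bar>"
    by (intro mult_left_mono) auto
  also have "\<dots> = \<bar>y ^ Suc n - z ^ Suc n\<bar>"
  proof -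
    have "y ^ Suc n - z ^ Suc n = (y - z) * (\<Sum>i<Suc n. y ^ i * z ^ (n - i))"
      unfolding diff_power_eq_sum by (simp add: mult.commute)
    then show ?thesis
      by (simp add: abs_mult)
  qed
  finally show ?thesis
    by (simp add: n)
qed

text \<open>
  Removing the term of degree $d - 1$ by a translation shows that the curve $p(y) = \varrho\, p(x)$
  approaches its asymptote at rate $1/y$.
\<close>

lemma dilated_level_curve_near_line:
  fixes p :: "real poly"
  assumes deg: "degree p = d" "d \<ge> 2" and lc: "lead_coeff p > 0"
  obtains k C x0 :: real where "k > 0" "C > 0" "x0 \<ge> 1"
    and "\<And>x. x \<ge> x0 \<Longrightarrow> k * x ^ d \<le> poly p x"
    and "\<And>x y. x0 \<le> x \<Longrightarrow> x < y \<Longrightarrow> poly p x < poly p y"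
    and "\<And>\<rho>. 0 < \<rho> \<Longrightarrow> \<rho> < 1 \<Longrightarrow> \<exists>\<alpha> \<beta>. \<forall>x y. x0 \<le> y \<longrightarrow> y \<le> x \<longrightarrow> poly p y = \<rho> * poly p x \<longrightarrow>
            k * \<rho> * x \<le> y \<and> \<bar>y - (\<alpha> * x + \<beta>)\<bar> \<le> C / y"
proof -
  define A where "A = lead_coeff p"
  have A: "A > 0"
    using lc by (simp add: A_def)
  obtain b q where q: "degree q \<le> d - 2" "\<And>x. poly p x = A * (x + b) ^ d + poly q x"
    unfolding A_def using complete_the_power[OF deg] by blast
  define S where "S = (\<Sum>i\<le>degree q. \<bar>coeff q i\<bar>)"
  have S: "S \<ge> 0"
    unfolding S_def by (intro sum_nonneg) auto
  have qS: "\<bar>poly q x\<bar> \<le> S * x ^ (d - 2)" if "x \<ge> 1" for x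
    unfolding S_def by (rule abs_poly_le_power[OF q(1) that])
  have "\<forall>\<^sub>F x in at_top. A / 2 * x ^ d \<le> poly p x \<and> poly p x \<le> 2 * A * x ^ d"
    using poly_eventually_between_multiples_of_lead_term[OF lc] deg by (simp add: A_def)
  moreover have "\<forall>\<^sub>F x in at_top. poly (pderiv p) x > 0"
  proof -
    have "lead_coeff (pderiv p) > 0"
      using deg lc by (simp add: degree_pderiv coeff_pderiv)
    then show ?thesis
      using poly_pinfty_gt_lc[of "pderiv p"] unfolding eventually_at_top_linorder by (meson less_le_trans)
  qed
  ultimately have "\<forall>\<^sub>F x in at_top. A / 2 * x ^ d \<le> poly p x \<and> poly p x \<le> 2 * A * x ^ d \<and> poly (pderiv p) x > 0"
    by eventually_elim auto
  then obtain x1 where x1: "\<And>x. x \<ge> x1 \<Longrightarrow> A / 2 * x ^ d \<le> poly p x \<and> poly p x \<le> 2 * A * x ^ d \<and> poly (pderiv p) x > 0"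
    unfolding eventually_at_top_linorder by blast
  \<comment> \<open>The term 2|b| ensures y + b >= y/2 for y >= \<open>x0\<close>.\<close>
  define x0 where "x0 = max x1 (max 1 (2 * \<bar>b\<bar>))"
  have x0: "x0 \<ge> 1" "x0 \<ge> x1" "x0 \<ge> 2 * \<bar>b\<bar>"
    by (auto simp: x0_def)
  \<comment> \<open>The factor 5 = 4 + 1 collects the remainders at x and y, 2^(d-1) pays for
    replacing y + b by y/2, and the summand 1 keeps \<open>C\<close> positive when \<open>S\<close>
    is 0.\<close>
  define C where "C = 5 * S * 2 ^ (d - 1) / A + 1"
  have C: "C > 0"
    using S A by (auto simp: C_def intro!: add_nonneg_pos divide_nonneg_pos mult_nonneg_nonneg)
  \<comment> \<open>The bound 1/4 serves the estimate k \<rho> x \<le> y, the bound A/2 the growth k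
    x^d \<le> p(x).\<close>
  define k where "k = min (1/4) (A / 2)"
  have k: "k > 0" "k \<le> 1/4" "k \<le> A / 2"
    using A by (auto simp: k_def)
  show ?thesis
  proof (rule that[of k C x0])
    show "k * x ^ d \<le> poly p x" if "x \<ge> x0" for x
    proof -
      have "k * x ^ d \<le> A / 2 * x ^ d"
        using k x0 that by (intro mult_right_mono) auto
      also have "\<dots> \<le> poly p x"
        using x1[of x] x0 that by auto
      finally show ?thesis .
    qed
    show "poly p x < poly p y" if "x0 \<le> x" "x < y" for x y
      by (rule DERIV_pos_imp_increasing[OF that(2)]) (use x1 x0 that poly_DERIV in \<open>meson order.trans\<close>)
    show "\<exists>\<alpha> \<beta>. \<forall>x y. x0 \<le> y \<longrightarrow> y \<le> x \<longrightarrow> poly p y = \<rho> * poly p x \<longrightarrow>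
            k * \<rho> * x \<le> y \<and> \<bar>y - (\<alpha> * x + \<beta>)\<bar> \<le> C / y" if \<rho>: "0 < \<rho>" "\<rho> < 1" for \<rho>
    proof (intro exI allI impI)
      fix x y
      assume xy: "x0 \<le> y" "y \<le> x" and eq: "poly p y = \<rho> * poly p x"
      \<comment> \<open>The asymptote is y + b = \<alpha> (x + b), so the witnesses are the slope
        \<open>root d \<rho>\<close> and the intercept \<open>root d \<rho> * b - b\<close>, which
        depend on \<rho> but not on the point.\<close>
      define \<alpha> where "\<alpha> = root d \<rho>"
      have \<alpha>: "\<alpha> \<ge> 0" "\<alpha> ^ d = \<rho>"
        using \<rho> deg by (auto simp: \<alpha>_def real_root_ge_zero)
      have pos: "x \<ge> 1" "y \<ge> 1" "x + b \<ge> 0" "y + b \<ge> y / 2"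
        using xy x0 by auto
      have "\<rho> * (A / 2 * x ^ d) \<le> \<rho> * poly p x"
        using x1[of x] xy x0 \<rho> by (intro mult_left_mono) auto
      also have "\<dots> \<le> 2 * A * y ^ d"
        using x1[of y] xy x0 eq by auto
      finally have "A * (\<rho> * x ^ d) \<le> A * (4 * y ^ d)"
        by (simp add: algebra_simps)
      then have \<rho>x: "\<rho> * x ^ d \<le> 4 * y ^ d"
        using A by simp
      \<comment> \<open>As y \<le> x, (y/x)^d is at most y/x, so y/x < \<rho>/4 would contradict
        \<rho> x^d \<le> 4 y^d.\<close>
      have "k * \<rho> * x \<le> y"
      proof (rule ccontr)
        assume "\<not> k * \<rho> * x \<le> y"
        moreover have "k * \<rho> * x \<le> 1 / 4 * \<rho> * x"
          using k \<rho> pos by (intro mult_right_mono) auto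
        ultimately have lt: "y / x < \<rho> / 4"
          using pos by (simp add: field_simps)
        have "(y / x) ^ d \<le> (y / x) ^ 1"
          using xy pos deg by (intro power_decreasing) auto
        also have "(y / x) ^ 1 < \<rho> / 4"
          using lt by (simp only: power_one_right)
        finally have "(y / x) ^ d < \<rho> / 4" .
        then have "4 * y ^ d < \<rho> * x ^ d"
          using pos by (simp add: power_divide field_simps)
        with \<rho>x show False
          by simp
      qed
      moreover have "\<bar>y - (root d \<rho> * x + (root d \<rho> * b - b))\<bar> \<le> C / y"
      proof -
        have "A * ((y + b) ^ d - (\<alpha> * (x + b)) ^ d) = \<rho> * poly q x - poly q y"
          using eq unfolding q(2) power_mult_distrib \<alpha>(2) by (simp add: algebra_simps)
        then have "A * \<bar>(y + b) ^ d - (\<alpha> * (x + b)) ^ d\<bar> = \<bar>\<rho> * poly q x - poly q y\<bar>"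
          using A by (metis abs_mult abs_of_pos)
        also have "\<dots> \<le> \<rho> * \<bar>poly q x\<bar> + \<bar>poly q y\<bar>"
          using \<rho> abs_triangle_ineq4[of "\<rho> * poly q x" "poly q y"] by (simp add: abs_mult)
        also have "\<dots> \<le> \<rho> * (S * x ^ (d - 2)) + S * y ^ (d - 2)"
          using qS pos \<rho> by (intro add_mono mult_left_mono) auto
        \<comment> \<open>After multiplication by x^2 this follows from \<rho> x^d \<le> 4 y^d,
          because y^2 \<le> x^2.\<close>
        also have "\<rho> * x ^ (d - 2) \<le> 4 * y ^ (d - 2)"
        proof -
          have d2: "d = (d - 2) + 2"
            using deg by simp
          have "(\<rho> * x ^ (d - 2)) * x\<^sup>2 = \<rho> * x ^ d"
            by (subst (2) d2) (simp only: power_add mult.assoc)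
          also have "\<dots> \<le> 4 * y ^ d"
            by (rule \<rho>x)
          also have "\<dots> = 4 * y ^ (d - 2) * y\<^sup>2"
            by (subst d2) (simp only: power_add mult.assoc)
          also have "\<dots> \<le> 4 * y ^ (d - 2) * x\<^sup>2"
            using pos xy by (intro mult_left_mono power_mono) auto
          finally show ?thesis
            using pos by simp
        qed
        then have "S * (\<rho> * x ^ (d - 2)) \<le> S * (4 * y ^ (d - 2))"
          using S by (rule mult_left_mono)
        then have "\<rho> * (S * x ^ (d - 2)) + S * y ^ (d - 2) \<le> 5 * S * y ^ (d - 2)"
          by (simp add: algebra_simps)
        finally have bound: "A * \<bar>(y + b) ^ d - (\<alpha> * (x + b)) ^ d\<bar> \<le> 5 * S * y ^ (d - 2)" .
        \<comment> \<open>The difference of d-th powers is O(y^(d-2)) and at least \<open>e\<close>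
          times a power of order y^(d-1), which leaves O(1/y) for \<open>e\<close>.\<close>
        define e where "e = \<bar>(y + b) - \<alpha> * (x + b)\<bar>"
        have "e * (y / 2) ^ (d - 1) \<le> e * (y + b) ^ (d - 1)"
          using pos by (intro mult_left_mono power_mono) (auto simp: e_def)
        also have "\<dots> \<le> \<bar>(y + b) ^ d - (\<alpha> * (x + b)) ^ d\<bar>"
          unfolding e_def using pos \<alpha> deg by (intro abs_diff_power_ge) auto
        finally have "A * (e * (y / 2) ^ (d - 1)) \<le> 5 * S * y ^ (d - 2)"
          using bound A by (meson mult_left_mono order.trans less_imp_le)
        moreover have "y ^ (d - 1) = y ^ (d - 2) * y"
        proof -
          have "d - 1 = Suc (d - 2)"
            using deg by simp
          then show ?thesis
            by simp
        qed
        ultimately have "(A * e * y) * y ^ (d - 2) \<le> (5 * S * 2 ^ (d - 1)) * y ^ (d - 2)"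
          by (simp add: power_divide field_simps)
        then have "A * e * y \<le> 5 * S * 2 ^ (d - 1)"
          by (rule mult_right_le_imp_le) (use pos in auto)
        then have "e * y \<le> 5 * S * 2 ^ (d - 1) / A"
          using A by (simp add: field_simps)
        then have "e * y \<le> C"
          by (simp add: C_def)
        then have "e \<le> C / y"
          using pos by (simp add: field_simps)
        moreover have "y - (root d \<rho> * x + (root d \<rho> * b - b)) = (y + b) - \<alpha> * (x + b)"
          by (simp add: \<alpha>_def algebra_simps)
        ultimately show ?thesis
          by (simp add: e_def)
      qed
      ultimately show "k * \<rho> * x \<le> y \<and> \<bar>y - (root d \<rho> * x + (root d \<rho> * b - b))\<bar> \<le> C / y"
        by blast
    qed
  qed (use k C x0 in auto)
qed

section \<open>Counting multiples, and counting lattice points on the curves block by block\<close>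

lemma card_multiples_le:
  fixes q :: int
  assumes "q > 0"
  shows "real (card {h \<in> {1..int N}. q dvd h}) \<le> real N / of_int q"
proof -
  have "{h \<in> {1..int N}. q dvd h} \<subseteq> (\<lambda>j. q * j) ` {1..int N div q}"
  proof
    fix h assume "h \<in> {h \<in> {1..int N}. q dvd h}"
    then obtain j where j: "h = q * j" "1 \<le> q * j" "q * j \<le> int N"
      by auto
    then have "0 < q * j"
      by linarith
    then have "0 < j"
      using assms by (simp add: zero_less_mult_iff)
    moreover have "q * j div q \<le> int N div q"
      using j assms by (intro zdiv_mono1) auto
    then have "j \<le> int N div q"
      using assms by simp
    ultimately show "h \<in> (\<lambda>j. q * j) ` {1..int N div q}"
      using j by auto
  qed
  then have "card {h \<in> {1..int N}. q dvd h} \<le> card ((\<lambda>j. q * j) ` {1..int N div q})"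
    by (intro card_mono) auto
  also have "\<dots> \<le> card {1..int N div q}"
    by (intro card_image_le) auto
  also have "\<dots> = nat (int N div q)"
    by simp
  finally have "real (card {h \<in> {1..int N}. q dvd h}) \<le> real (nat (int N div q))"
    by (rule of_nat_mono)
  also have "\<dots> = real_of_int (int N div q)"
    using assms by (simp add: pos_imp_zdiv_nonneg_iff)
  also have "\<dots> \<le> real N / of_int q"
    using real_of_int_div4[of "int N" q] by simp
  finally show ?thesis .
qed

text \<open>Sorting the elements a by floor (a / L) gives at most N/L + 1 classes, indexed by 0,
  ..., floor (N / L), and two elements of one class differ by at most \<open>L\<close>.\<close>

lemma card_le_by_blocks:
  fixes A :: "int set" and L :: real
  assumes A: "A \<subseteq> {1..int N}" and L: "L > 0"
    and B: "\<And>B. B \<subseteq> A \<Longrightarrow> (\<And>x y. x \<in> B \<Longrightarrow> y \<in> B \<Longrightarrow> \<bar>real_of_int x - of_int y\<bar> \<le> L) \<Longrightarrow> card B \<le> D"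
  shows "real (card A) \<le> real D * (real N / L + 1)"
proof -
  define I where "I = {0..\<lfloor>real N / L\<rfloor>}"
  define S where "S = (\<lambda>i. {a \<in> A. \<lfloor>of_int a / L\<rfloor> = i})"
  have "A = (\<Union>i\<in>I. S i)"
    using A L by (force simp: I_def S_def intro!: floor_mono divide_right_mono)
  then have "card A \<le> (\<Sum>i\<in>I. card (S i))"
    by (metis card_UN_le I_def finite_atLeastAtMost_int)
  also have "\<dots> \<le> (\<Sum>i\<in>I. D)"
  proof (intro sum_mono B)
    fix i x y assume "x \<in> S i" "y \<in> S i"
    then have "\<lfloor>of_int x / L\<rfloor> = i" "\<lfloor>of_int y / L\<rfloor> = i"
      by (auto simp: S_def)
    then have "of_int i \<le> of_int x / L" "of_int x / L < of_int i + 1"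
      "of_int i \<le> of_int y / L" "of_int y / L < of_int i + 1"
      by linarith+
    then have "\<bar>of_int x / L - of_int y / L\<bar> \<le> 1"
      by linarith
    then have "\<bar>real_of_int x - of_int y\<bar> / L \<le> 1"
      using L by (simp flip: diff_divide_distrib)
    then show "\<bar>real_of_int x - of_int y\<bar> \<le> L"
      using L by (simp add: field_simps)
  qed (auto simp: S_def)
  also have "\<dots> = card I * D"
    by simp
  finally have "real (card A) \<le> real (card I) * real D"
    by (metis of_nat_le_iff of_nat_mult)
  also have "real (card I) \<le> real N / L + 1"
  proof -
    have "real N / L \<ge> 0"
      using L by simp
    then show ?thesis
      unfolding I_def by (simp add: add.commute)
  qed
  finally show ?thesis
    by (simp add: mult.commute mult_right_mono)
qed

text \<open>
  Three lattice points in the block span a triangle whose doubled area is an integer less than 1,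
  so all of them lie on one line.
\<close>

lemma card_block_le_degree:
  fixes f :: "int poly" and \<phi> :: "int \<Rightarrow> int" and \<alpha> \<beta> E L :: real
  assumes deg: "degree f > 0"
    and z: "poly (map_poly of_int f) (z\<^sub>1::complex) = 0" "poly (map_poly of_int f) z\<^sub>2 = 0" "z\<^sub>1 \<noteq> z\<^sub>2"
    and rs: "0 < r" "r < s"
    and eq: "\<And>a. a \<in> B \<Longrightarrow> s * poly f (\<phi> a) = r * poly f a"
    and E: "\<And>a. a \<in> B \<Longrightarrow> \<bar>of_int (\<phi> a) - (\<alpha> * of_int a + \<beta>)\<bar> \<le> E"
    and L: "\<And>a b. a \<in> B \<Longrightarrow> b \<in> B \<Longrightarrow> \<bar>real_of_int a - of_int b\<bar> \<le> L"
    and LE: "4 * L * E < 1"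
  shows "card B \<le> degree f"
proof (rule ccontr)
  assume "\<not> card B \<le> degree f"
  then have card: "card B > degree f"
    by simp
  then have "\<exists>a b. a \<in> B \<and> b \<in> B \<and> a \<noteq> b"
    using deg by (metis One_nat_def card.infinite card_le_Suc0_iff_eq less_nat_zero_code not_less_eq_eq Suc_leI order.strict_trans1)
  then obtain a b where ab: "a \<in> B" "b \<in> B" "a \<noteq> b"
    by blast
  define c where "c = (real_of_int (\<phi> b) - of_int (\<phi> a)) / (of_int b - of_int a)"
  define t where "t = of_int (\<phi> a) - c * of_int a"
  define e where "e = (\<lambda>x. of_int (\<phi> x) - (\<alpha> * of_int x + \<beta>))"
  have line: "of_int (\<phi> x) = c * of_int x + t" if x: "x \<in> B" for x
  proof -
    define D where "D = (b - a) * (\<phi> x - \<phi> a) - (x - a) * (\<phi> b - \<phi> a)"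
    \<comment> \<open>Subtracting an affine function from \<open>\<phi>\<close> leaves the
      determinant unchanged, so only the deviations \<open>e\<close>, each at most \<open>E\<close>
      in absolute value, enter the bound 4 L E.\<close>
    have "real_of_int D = (of_int b - of_int a) * (e x - e a) - (of_int x - of_int a) * (e b - e a)"
      by (simp add: D_def e_def algebra_simps)
    also have "\<bar>\<dots>\<bar> \<le> \<bar>real_of_int b - of_int a\<bar> * \<bar>e x - e a\<bar> + \<bar>of_int x - of_int a\<bar> * \<bar>e b - e a\<bar>"
      by (metis abs_mult abs_triangle_ineq4)
    also have "\<dots> \<le> L * (2 * E) + L * (2 * E)"
      using L[OF ab(2,1)] L[OF x ab(1)] E[OF x] E[OF ab(1)] E[OF ab(2)]
      by (intro add_mono mult_mono) (auto simp: e_def)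
    also have "\<dots> < 1"
      using LE by (simp add: mult_ac)
    finally have "D = 0"
      by simp
    then have "(real_of_int b - of_int a) * (of_int (\<phi> x) - of_int (\<phi> a))
             = (of_int x - of_int a) * (of_int (\<phi> b) - of_int (\<phi> a))"
      unfolding D_def by (metis (no_types, opaque_lifting) eq_iff_diff_eq_0 of_int_diff of_int_mult)
    then have "of_int (\<phi> x) - of_int (\<phi> a) = (of_int x - of_int a) * c"
      using ab(3) by (simp add: c_def field_simps)
    then show ?thesis
      by (simp add: t_def algebra_simps)
  qed
  show False
  proof (rule no_affine_self_similarity[OF deg z rs, of "real_of_int ` B" c t])
    show "finite (real_of_int ` B)"
      using card card.infinite by fastforce
    show "card (real_of_int ` B) > degree f"
      using card by (simp add: card_image inj_on_def)
    show "of_int s * poly (map_poly of_int f) (c * x + t) = of_int r * poly (map_poly of_int f) x"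
      if "x \<in> real_of_int ` B" for x
    proof -
      obtain y where y: "x = of_int y" "y \<in> B"
        using \<open>x \<in> real_of_int ` B\<close> by blast
      have "real_of_int (s * poly f (\<phi> y)) = real_of_int (r * poly f y)"
        using eq[OF y(2)] by simp
      then show ?thesis
        unfolding y(1) line[OF y(2), symmetric] poly_map_poly_of_int_of_int by simp
    qed
  qed
qed

text \<open>Blocks of length proportional to (r/s) sqrt N contain at most \<open>degree f\<close>
  solutions each. The restriction a > sqrt N keeps u of order at least (r/s) sqrt N, where the error
  C/u of the asymptote is small. Growth and monotonicity are exported with the same threshold
  \<open>x0\<close>.\<close>

lemma card_solutions_le:
  fixes f :: "int poly"
  assumes deg: "degree f \<ge> 2" and lc: "lead_coeff f > 0"
    and z: "poly (map_poly of_int f) (z\<^sub>1::complex) = 0" "poly (map_poly of_int f) z\<^sub>2 = 0" "z\<^sub>1 \<noteq> z\<^sub>2"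
  obtains k K x0 :: real where "k > 0" "K > 0" "x0 \<ge> 1"
    and "\<And>a. of_int a \<ge> x0 \<Longrightarrow> k * (of_int a)\<^sup>2 \<le> of_int (poly f a)"
    and "\<And>a b. of_int a \<ge> x0 \<Longrightarrow> a < b \<Longrightarrow> poly f a < poly f b"
    and "\<And>N r s. 0 < N \<Longrightarrow> 0 < r \<Longrightarrow> r < s \<Longrightarrow>
           real (card {a \<in> {1..int N}. sqrt N < of_int a \<and>
             (\<exists>u. x0 \<le> of_int u \<and> u < a \<and> s * poly f u = r * poly f a)})
           \<le> K * sqrt N * of_int s / of_int r"
proof -
  define p :: "real poly" where "p = map_poly of_int f"
  have degp: "degree p = degree f"
    by (simp add: p_def degree_map_poly)
  have lcp: "lead_coeff p > 0"
    using lc by (simp add: degp) (simp add: p_def coeff_map_poly)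
  have pf: "poly p (of_int a) = of_int (poly f a)" for a
    by (simp add: p_def poly_map_poly_of_int_of_int)
  obtain k C x0 :: real where k: "k > 0" and C: "C > 0" and x0: "x0 \<ge> 1"
    and lower: "\<And>x. x \<ge> x0 \<Longrightarrow> k * x ^ degree f \<le> poly p x"
    and mono: "\<And>x y. x0 \<le> x \<Longrightarrow> x < y \<Longrightarrow> poly p x < poly p y"
    and near: "\<And>\<rho>. 0 < \<rho> \<Longrightarrow> \<rho> < 1 \<Longrightarrow> \<exists>\<alpha> \<beta>. \<forall>x y. x0 \<le> y \<longrightarrow> y \<le> x \<longrightarrow> poly p y = \<rho> * poly p x \<longrightarrow>
            k * \<rho> * x \<le> y \<and> \<bar>y - (\<alpha> * x + \<beta>)\<bar> \<le> C / y"
    using dilated_level_curve_near_line[OF degp deg lcp] by blast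
  \<comment> \<open>8 C / k comes from the number of blocks; the 1 pays for the extra block, as sqrt
    N * s / r is at least 1.\<close>
  define K where "K = real (degree f) * (8 * C / k + 1)"
  show ?thesis
  proof (rule that[of k K x0])
    show "K > 0"
      using k C deg by (auto simp: K_def intro!: mult_pos_pos add_pos_pos)
    show "k * (of_int a)\<^sup>2 \<le> of_int (poly f a)" if "of_int a \<ge> x0" for a
    proof -
      have "k * (of_int a)\<^sup>2 \<le> k * (of_int a) ^ degree f"
        using k deg x0 that by (intro mult_left_mono power_increasing) auto
      also have "\<dots> \<le> poly p (of_int a)"
        by (rule lower[OF that])
      finally show ?thesis
        by (simp add: pf)
    qed
    show "poly f a < poly f b" if "of_int a \<ge> x0" "a < b" for a b
      using mono[OF that(1), of "of_int b"] that(2) by (simp add: pf)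
  next
    fix N :: nat and r s :: int
    assume N: "0 < N" and rs: "0 < r" "r < s"
    define A where "A = {a \<in> {1..int N}. sqrt N < of_int a \<and>
             (\<exists>u. x0 \<le> of_int u \<and> u < a \<and> s * poly f u = r * poly f a)}"
    have "\<forall>a\<in>A. \<exists>u. x0 \<le> of_int u \<and> u < a \<and> s * poly f u = r * poly f a"
      by (auto simp: A_def)
    then obtain \<phi> where \<phi>: "\<And>a. a \<in> A \<Longrightarrow> x0 \<le> of_int (\<phi> a) \<and> \<phi> a < a \<and> s * poly f (\<phi> a) = r * poly f a"
      by metis
    define \<rho> where "\<rho> = real_of_int r / of_int s"
    have \<rho>: "0 < \<rho>" "\<rho> < 1"
      using rs by (auto simp: \<rho>_def)
    obtain \<alpha> \<beta> where \<alpha>\<beta>: "\<And>x y. x0 \<le> y \<Longrightarrow> y \<le> x \<Longrightarrow> poly p y = \<rho> * poly p x \<Longrightarrow>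
            k * \<rho> * x \<le> y \<and> \<bar>y - (\<alpha> * x + \<beta>)\<bar> \<le> C / y"
      using near[OF \<rho>] by blast
    \<comment> \<open>\<open>Y\<close> is a lower bound for \<open>\<phi> a\<close>, since
      \<open>\<phi> a\<close> is at least k \<rho> a and a > sqrt N.\<close>
    define Y where "Y = k * \<rho> * sqrt N"
    have Y: "Y > 0"
      using k \<rho> N by (simp add: Y_def)
    have close: "\<bar>of_int (\<phi> a) - (\<alpha> * of_int a + \<beta>)\<bar> \<le> C / Y" if "a \<in> A" for a
    proof -
      have "real_of_int (s * poly f (\<phi> a)) = of_int (r * poly f a)"
        using \<phi>[OF that] by simp
      then have "poly p (of_int (\<phi> a)) = \<rho> * poly p (of_int a)"
        using rs by (simp add: pf \<rho>_def field_simps)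
      then have *: "k * \<rho> * of_int a \<le> of_int (\<phi> a)"
          "\<bar>of_int (\<phi> a) - (\<alpha> * of_int a + \<beta>)\<bar> \<le> C / of_int (\<phi> a)"
        using \<alpha>\<beta>[of "of_int (\<phi> a)" "of_int a"] \<phi>[OF that] by auto
      have "Y \<le> k * \<rho> * of_int a"
        unfolding Y_def using that k \<rho> by (intro mult_left_mono) (auto simp: A_def)
      then have "Y \<le> of_int (\<phi> a)"
        using * by simp
      then have "C / of_int (\<phi> a) \<le> C / Y"
        using C Y by (intro divide_left_mono) auto
      with * show ?thesis
        by linarith
    qed
    \<comment> \<open>Block length Y/(8C) against deviation C/Y gives 4 L E = 1/2, safely below
      1.\<close>
    have "real (card A) \<le> real (degree f) * (real N / (Y / (8 * C)) + 1)"
    proof (rule card_le_by_blocks)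
      show "A \<subseteq> {1..int N}" "Y / (8 * C) > 0"
        using Y C by (auto simp: A_def)
      fix B assume B: "B \<subseteq> A"
        "\<And>x y. x \<in> B \<Longrightarrow> y \<in> B \<Longrightarrow> \<bar>real_of_int x - of_int y\<bar> \<le> Y / (8 * C)"
      show "card B \<le> degree f"
      proof (rule card_block_le_degree[OF _ z rs, where \<phi> = \<phi> and \<alpha> = \<alpha> and \<beta> = \<beta> and E = "C / Y" and L = "Y / (8 * C)"])
        show "4 * (Y / (8 * C)) * (C / Y) < 1"
          using Y C by simp
      qed (use B \<phi> close deg in auto)
    qed
    also have "real N / (Y / (8 * C)) = 8 * C / k * (sqrt N * of_int s / of_int r)"
    proof -
      have "real N = sqrt N * sqrt N"
        by simp
      then have "real N / (Y / (8 * C)) = (sqrt N * sqrt N) / (Y / (8 * C))"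
        by simp
      also have "\<dots> = 8 * C / k * (sqrt N * of_int s / of_int r)"
        using N k rs C by (simp add: Y_def \<rho>_def field_simps del: real_sqrt_mult_self)
      finally show ?thesis .
    qed
    also have "real (degree f) * (8 * C / k * (sqrt N * of_int s / of_int r) + 1)
        \<le> real (degree f) * (8 * C / k * (sqrt N * of_int s / of_int r) + sqrt N * of_int s / of_int r)"
    proof -
      have "1 \<le> sqrt N * (of_int s / of_int r)"
        using N rs by (intro mult_ge1_I) auto
      then show ?thesis
        by (intro mult_left_mono add_left_mono) auto
    qed
    also have "\<dots> = K * sqrt N * of_int s / of_int r"
      by (simp add: K_def algebra_simps add_divide_distrib)
    finally show "real (card {a \<in> {1..int N}. sqrt N < of_int a \<and>
             (\<exists>u. x0 \<le> of_int u \<and> u < a \<and> s * poly f u = r * poly f a)}) \<le> K * sqrt N * of_int s / of_int r"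
      by (simp add: A_def)
  qed (use k x0 in auto)
qed

section \<open>Invisible points and divisibility of their heights\<close>

text \<open>The scale t is forced to be h / F(a), so invisibility supplies u < a with t F(u) a
  positive integer k. With f(u)/f(a) = r/s in lowest terms, h r^m = k s^m, and coprimality yields
  the divisibility. Only \<open>r \<noteq> 0\<close> is claimed because f(u) may be negative when m
  is even.\<close>

lemma invisible_along_powerE:
  fixes f :: "int poly"
  assumes inv: "invisible_along (f ^ m) (a, h)" and pos: "poly f a > 0" and m: "m > 0"
  obtains u g r s where "0 < u" "u < a" "g > 0" "poly f u = g * r" "poly f a = g * s" "r \<noteq> 0" "s > 0" "s ^ m dvd h"
proof -
  define t :: rat where "t = of_int h / of_int (poly (f ^ m) a)"
  define U where "U = {u::int. 0 < u \<and> t * of_int (poly (f ^ m) u) \<in> \<int> \<and> 0 < t * of_int (poly (f ^ m) u)}"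
  have ah: "0 < a" "0 < h"
    using inv by (auto simp: invisible_along_def)
  have Fa: "poly (f ^ m) a > 0"
    using pos by simp
  have th: "of_int h = t * of_int (poly (f ^ m) a)"
    using pos by (simp add: t_def)
  then have "a \<in> U"
    using ah unfolding U_def by (simp flip: th del: poly_power)
  moreover have "\<not> (a \<in> U \<and> (\<forall>u\<in>U. a \<le> u))"
    using inv th unfolding invisible_along_def visible_along_def U_def Let_def by auto
  ultimately obtain u where u: "u \<in> U" "u < a"
    by (auto simp: not_le)
  then obtain k where k: "t * of_int (poly (f ^ m) u) = of_int k"
    by (auto simp: U_def elim: Ints_cases)
  have "0 < rat_of_int k"
    using u unfolding U_def k[symmetric] by blast
  then have "k > 0"
    by simp
  have "rat_of_int (h * poly (f ^ m) u) = of_int (k * poly (f ^ m) a)"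
    using k Fa by (simp add: t_def field_simps del: poly_power)
  then have hk: "h * poly f u ^ m = k * poly f a ^ m"
    unfolding of_int_eq_iff by simp
  define g where "g = gcd (poly f u) (poly f a)"
  have g: "g > 0"
    using pos by (simp add: g_def)
  define r where "r = poly f u div g"
  define s where "s = poly f a div g"
  have rs: "poly f u = g * r" "poly f a = g * s"
    by (simp_all add: r_def s_def g_def)
  have cop: "coprime r s"
    using pos unfolding r_def s_def g_def by (intro div_gcd_coprime) auto
  have "s > 0"
    using pos g unfolding rs by (simp add: zero_less_mult_iff)
  have "h * r ^ m = k * s ^ m"
    using hk g by (simp add: rs power_mult_distrib)
  then have "s ^ m dvd h * r ^ m"
    by simp
  then have "s ^ m dvd h"
    using cop by (simp add: coprime_commute coprime_dvd_mult_left_iff)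
  moreover have "r \<noteq> 0"
    using \<open>h * r ^ m = k * s ^ m\<close> m \<open>k > 0\<close> \<open>s > 0\<close> by (auto simp: zero_power)
  ultimately show ?thesis
    using that[of u g r s] u g rs \<open>s > 0\<close> by (auto simp: U_def)
qed

text \<open>The differences ln (n+1) - ln n telescope and dominate 1/(n+1), by ln x \<le> x - 1 at x
  = n/(n+1).\<close>

lemma sum_inverse_le_ln:
  assumes "N > 0"
  shows "(\<Sum>i\<in>{1..int N}. 1 / real_of_int i) \<le> 1 + ln (real N)"
  using assms
proof (induction N rule: nat_induct_non_zero)
  case (Suc n)
  have "{1..int (Suc n)} = insert (int (Suc n)) {1..int n}"
    by auto
  then have "(\<Sum>i\<in>{1..int (Suc n)}. 1 / real_of_int i) = 1 / real (Suc n) + (\<Sum>i\<in>{1..int n}. 1 / real_of_int i)"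
    by simp
  moreover have "ln (real n / real (Suc n)) \<le> real n / real (Suc n) - 1"
    using Suc by (intro ln_le_minus_one) auto
  then have "1 / real (Suc n) \<le> ln (real (Suc n)) - ln (real n)"
    using Suc by (simp add: ln_div field_simps)
  ultimately show ?case
    using Suc by simp
qed auto

section \<open>The count of invisible points\<close>

text \<open>The summand N sqrt N counts all points with a \<le> sqrt N trivially; the other summand
  comes from the pairs (r, s), whose weights 1/(r s) add up to a squared logarithm.\<close>

lemma card_invisible_le:
  fixes f :: "int poly"
  assumes deg: "degree f \<ge> 2" and lc: "lead_coeff f > 0"
    and z: "poly (map_poly of_int f) (z\<^sub>1::complex) = 0" "poly (map_poly of_int f) z\<^sub>2 = 0" "z\<^sub>1 \<noteq> z\<^sub>2"
    and m: "m \<ge> 2"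
  obtains K :: real where "K > 0"
    "\<forall>\<^sub>F N in sequentially. real (card {(a, h) \<in> {1..int N} \<times> {1..int N}. invisible_along (f ^ m) (a, h)})
       \<le> real N * sqrt N + K * real N * sqrt N * (1 + ln (real N))\<^sup>2"
proof -
  obtain k K x0 :: real where k: "k > 0" and K: "K > 0" and x0: "x0 \<ge> 1"
    and lower: "\<And>a. of_int a \<ge> x0 \<Longrightarrow> k * (of_int a)\<^sup>2 \<le> of_int (poly f a)"
    and mono: "\<And>a b. of_int a \<ge> x0 \<Longrightarrow> a < b \<Longrightarrow> poly f a < poly f b"
    and count: "\<And>N r s. 0 < N \<Longrightarrow> 0 < r \<Longrightarrow> r < s \<Longrightarrow>
           real (card {a \<in> {1..int N}. sqrt N < of_int a \<and>
             (\<exists>u. x0 \<le> of_int u \<and> u < a \<and> s * poly f u = r * poly f a)})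
           \<le> K * sqrt N * of_int s / of_int r"
    using card_solutions_le[OF deg lc z] by blast
  \<comment> \<open>Growth and monotonicity of f are known only from \<open>x0\<close> on;
    \<open>M\<close> bounds |f| at the finitely many positive integers below.\<close>
  define M where "M = (\<Sum>u\<in>{1..\<lceil>x0\<rceil>}. \<bar>poly f u\<bar>)"
  have M: "\<bar>poly f u\<bar> \<le> M" if "0 < u" "of_int u < x0" for u
    unfolding M_def using that by (intro member_le_sum) (auto simp: le_ceiling_iff)
  \<comment> \<open>sqrt N > x0 makes the estimates available for every a > sqrt N, and sqrt N > M/k
    will exclude u < x0.\<close>
  have "\<forall>\<^sub>F N in sequentially. sqrt (real N) > max x0 (of_int M / k)"
    by (intro filterlim_at_top_dense[THEN iffD1, rule_format]) real_asymp
  then have "\<forall>\<^sub>F N in sequentially. real (card {(a, h) \<in> {1..int N} \<times> {1..int N}. invisible_along (f ^ m) (a, h)})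
       \<le> real N * sqrt N + K * real N * sqrt N * (1 + ln (real N))\<^sup>2"
  proof eventually_elim
    case (elim N)
    have N: "N > 0"
      using elim x0 by (cases N) auto
    define A where "A = (\<lambda>r s. {a \<in> {1..int N}. sqrt N < of_int a \<and>
             (\<exists>u. x0 \<le> of_int u \<and> u < a \<and> s * poly f u = r * poly f a)})"
    \<comment> \<open>As m \<ge> 2, s^m dividing h implies that s^2 does, and the square already
      suffices for the bound.\<close>
    define H where "H = (\<lambda>s. {h \<in> {1..int N}. s\<^sup>2 dvd h})"
    define P where "P = {(r, s) \<in> {1..int N} \<times> {1..int N}. r < s}"
    define J where "J = {(a, h) \<in> {1..int N} \<times> {1..int N}. invisible_along (f ^ m) (a, h)}"
    have "finite P"
      unfolding P_def by (rule finite_subset[of _ "{1..int N} \<times> {1..int N}"]) auto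
    moreover have "finite (A r s)" "finite (H s)" for r s
      unfolding A_def H_def by (simp_all del: atLeastAtMost_iff)
    ultimately have fin: "finite P" "finite (A r s)" "finite (H s)" for r s
      by blast+
    have J: "J \<subseteq> {1..\<lfloor>sqrt N\<rfloor>} \<times> {1..int N} \<union> (\<Union>(r, s)\<in>P. A r s \<times> H s)"
    proof (rule subsetI)
      fix ah assume "ah \<in> J"
      then obtain a h where ah: "ah = (a, h)" "a \<in> {1..int N}" "h \<in> {1..int N}" "invisible_along (f ^ m) (a, h)"
        by (auto simp: J_def)
      show "ah \<in> {1..\<lfloor>sqrt N\<rfloor>} \<times> {1..int N} \<union> (\<Union>(r, s)\<in>P. A r s \<times> H s)"
      proof (cases "of_int a \<le> sqrt N")
        case True
        then show ?thesis
          using ah by (auto simp: le_floor_iff)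
      next
        case False
        then have a: "sqrt N < of_int a" "x0 \<le> of_int a"
          using elim by auto
        have "0 < k * (of_int a)\<^sup>2"
          using k a x0 by (intro mult_pos_pos) auto
        also have "\<dots> \<le> of_int (poly f a)"
          by (rule lower) fact
        finally have fa: "poly f a > 0"
          by simp
        obtain u g r s where u: "0 < u" "u < a" "g > 0" "poly f u = g * r" "poly f a = g * s" "r \<noteq> 0" "s > 0" "s ^ m dvd h"
          using m by (elim invisible_along_powerE[OF ah(4) fa, rotated]) auto
        have sh: "s\<^sup>2 dvd h"
          using u(8) m by (meson dvd_trans le_imp_power_dvd)
        have "s\<^sup>2 \<le> h"
          using sh ah by (intro zdvd_imp_le) auto
        then have s2: "s\<^sup>2 \<le> int N"
          using ah by simp
        then have "(real_of_int s)\<^sup>2 \<le> real N"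
          by (metis of_int_le_iff of_int_of_nat_eq of_int_power)
        then have ssqrt: "of_int s \<le> sqrt N"
          by (rule real_le_rsqrt)
        \<comment> \<open>Otherwise f(a) \<le> |r| f(a) = s |f(u)| \<le> sqrt N * M < k N \<le> k
          a^2 \<le> f(a), where s \<le> sqrt N because s^2 divides h.\<close>
        have "x0 \<le> of_int u"
        proof (rule ccontr)
          assume "\<not> x0 \<le> of_int u"
          then have "\<bar>poly f u\<bar> \<le> M"
            using M[OF u(1)] by simp
          have "poly f a * 1 \<le> poly f a * \<bar>r\<bar>"
            using u fa by (intro mult_left_mono) auto
          also have "\<dots> = s * \<bar>poly f u\<bar>"
            using u by (simp add: abs_mult)
          also have "\<dots> \<le> s * M"
            using u \<open>\<bar>poly f u\<bar> \<le> M\<close> by (intro mult_left_mono) auto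
          finally have "real_of_int (poly f a) \<le> of_int s * of_int M"
            by (metis mult.right_neutral of_int_le_iff of_int_mult)
          also have "\<dots> \<le> sqrt N * of_int M"
            using ssqrt \<open>\<bar>poly f u\<bar> \<le> M\<close> by (intro mult_right_mono) auto
          also have "\<dots> < sqrt N * (k * sqrt N)"
            using elim k N by (intro mult_strict_left_mono) (auto simp: field_simps)
          also have "\<dots> = k * (sqrt N)\<^sup>2"
            by (simp add: power2_eq_square)
          also have "\<dots> \<le> k * (of_int a)\<^sup>2"
            using a k by (intro mult_left_mono power_mono) auto
          also have "\<dots> \<le> of_int (poly f a)"
            by (rule lower) fact
          finally show False
            by simp
        qed
        have "0 < k * (of_int u)\<^sup>2"
          using k \<open>x0 \<le> of_int u\<close> x0 by (intro mult_pos_pos) auto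
        also have "\<dots> \<le> of_int (poly f u)"
          by (rule lower) fact
        finally have "poly f u > 0"
          by simp
        then have "g * r > 0"
          by (simp only: u(4))
        then have r: "r > 0"
          using u by (simp add: zero_less_mult_iff)
        have "g * r < g * s"
          using mono[OF \<open>x0 \<le> of_int u\<close> u(2)] u by simp
        then have "r < s"
          using u by simp
        have "s * 1 \<le> s * s"
          using u by (intro mult_left_mono) auto
        then have "s \<le> int N"
          using s2 by (simp add: power2_eq_square)
        then have "(r, s) \<in> P"
          using r \<open>r < s\<close> by (auto simp: P_def)
        moreover have "s * poly f u = r * poly f a"
          using u by simp
        then have "a \<in> A r s"
          using a ah u \<open>x0 \<le> of_int u\<close> unfolding A_def by blast
        moreover have "h \<in> H s"
          using ah sh by (simp add: H_def)
        ultimately show ?thesis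
          using ah by blast
      qed
    qed
    have "card J \<le> card ({1..\<lfloor>sqrt N\<rfloor>} \<times> {1..int N} \<union> (\<Union>(r, s)\<in>P. A r s \<times> H s))"
      using fin by (intro card_mono J) auto
    also have "\<dots> \<le> card ({1..\<lfloor>sqrt N\<rfloor>} \<times> {1..int N}) + card (\<Union>(r, s)\<in>P. A r s \<times> H s)"
      by (rule card_Un_le)
    also have "card (\<Union>(r, s)\<in>P. A r s \<times> H s) \<le> (\<Sum>(r, s)\<in>P. card (A r s) * card (H s))"
      using card_UN_le[OF fin(1), of "\<lambda>(r, s). A r s \<times> H s"] by (simp add: case_prod_unfold card_cartesian_product)
    finally have "card J \<le> nat \<lfloor>sqrt N\<rfloor> * N + (\<Sum>(r, s)\<in>P. card (A r s) * card (H s))"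
      by (simp add: card_cartesian_product)
    then have "real (card J) \<le> real (nat \<lfloor>sqrt N\<rfloor> * N + (\<Sum>(r, s)\<in>P. card (A r s) * card (H s)))"
      by (rule of_nat_mono)
    also have "\<dots> = real (nat \<lfloor>sqrt N\<rfloor>) * N + (\<Sum>(r, s)\<in>P. real (card (A r s)) * real (card (H s)))"
      by (simp add: case_prod_unfold)
    also have "\<dots> \<le> sqrt N * N + (\<Sum>(r, s)\<in>P. K * N * sqrt N * ((1 / of_int r) * (1 / of_int s)))"
    proof (intro add_mono mult_right_mono sum_mono)
      fix rs assume "rs \<in> P"
      then obtain r s where rs: "rs = (r, s)" "0 < r" "r < s"
        by (auto simp: P_def)
      \<comment> \<open>The factor s/r from counting a meets 1/s^2 from counting h, which leaves the
        weight 1/(r s).\<close>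
      have "real (card (A r s)) * real (card (H s)) \<le> (K * sqrt N * of_int s / of_int r) * (real N / of_int (s\<^sup>2))"
        using count[OF N rs(2,3)] card_multiples_le[of "s\<^sup>2" N] rs unfolding A_def H_def
        by (intro mult_mono) auto
      also have "\<dots> = K * N * sqrt N * ((1 / of_int r) * (1 / of_int s))"
        using rs by (simp add: power2_eq_square)
      finally show "(case rs of (r, s) \<Rightarrow> real (card (A r s)) * real (card (H s)))
          \<le> (case rs of (r, s) \<Rightarrow> K * N * sqrt N * ((1 / of_int r) * (1 / of_int s)))"
        by (simp add: rs)
    qed auto
    \<comment> \<open>Dropping the constraint r < s makes the double sum factor into the square of a
      harmonic sum.\<close>
    also have "(\<Sum>(r, s)\<in>P. K * N * sqrt N * ((1 / of_int r) * (1 / of_int s)))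
        \<le> (\<Sum>(r, s)\<in>{1..int N} \<times> {1..int N}. K * N * sqrt N * ((1 / of_int r) * (1 / of_int s)))"
      using K by (intro sum_mono2) (auto simp: P_def)
    also have "\<dots> = K * N * sqrt N * (\<Sum>i\<in>{1..int N}. 1 / of_int i)\<^sup>2"
      unfolding power2_eq_square sum_product sum.cartesian_product case_prod_unfold
      by (rule sum_distrib_left[symmetric])
    also have "\<dots> \<le> K * N * sqrt N * (1 + ln (real N))\<^sup>2"
      using K by (intro mult_left_mono power_mono sum_inverse_le_ln N sum_nonneg) auto
    finally show ?case
      by (simp add: J_def mult.commute)
  qed
  with K show ?thesis
    using that by blast
qed

theorem theorem1p3:
  fixes f F :: "int poly" and m :: nat
  assumes "degree f \<ge> 2"
    and "lead_coeff f > 0"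
    and "card {z::complex. algebraic z \<and> poly (map_poly of_int f) z = 0} \<ge> 2"
    and "m \<ge> 2"
    and "F = f ^ m"
  shows "\<exists>\<delta>::nat. \<delta> \<ge> 2 \<and>
    (\<forall>r s :: int. 0 < r \<and> r < s \<longrightarrow>
       (\<forall>p :: real poly poly. irreducible p \<and> p dvd G_poly f s r \<longrightarrow> \<not> total_degree p < \<delta>)) \<and>
    (\<forall>\<epsilon>::real. \<epsilon> > 0 \<longrightarrow>
       (\<lambda>N::nat. real (card {(a, h) \<in> {1..int N} \<times> {1..int N}. invisible_along F (a, h)}))
         \<in> O(\<lambda>N. real N powr (1 + 1 / real \<delta> + \<epsilon>)))"
proof -
  define Z where "Z = {z::complex. algebraic z \<and> poly (map_poly of_int f) z = 0}"
  have Z2: "\<not> card Z \<le> Suc 0"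
    using assms(3) unfolding Z_def[symmetric] by simp
  \<comment> \<open>An infinite set has \<open>card\<close> 0, so the lower bound on the cardinality
    also yields finiteness.\<close>
  then have "finite Z"
    by (metis card.infinite le0)
  with Z2 obtain z\<^sub>1 z\<^sub>2 where "z\<^sub>1 \<in> Z" "z\<^sub>2 \<in> Z" "z\<^sub>1 \<noteq> z\<^sub>2"
    using card_le_Suc0_iff_eq by blast
  then have z: "poly (map_poly of_int f) z\<^sub>1 = 0" "poly (map_poly of_int f) z\<^sub>2 = 0" "z\<^sub>1 \<noteq> z\<^sub>2"
    by (auto simp: Z_def)
  obtain K :: real where K: "K > 0"
    "\<forall>\<^sub>F N in sequentially. real (card {(a, h) \<in> {1..int N} \<times> {1..int N}. invisible_along F (a, h)})
       \<le> real N * sqrt N + K * real N * sqrt N * (1 + ln (real N))\<^sup>2"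
    using card_invisible_le[OF assms(1,2) z assms(4)] unfolding assms(5) by blast
  show ?thesis
  proof (intro exI[of _ 2] conjI allI impI)
    fix r s :: int and p :: "real poly poly"
    assume "0 < r \<and> r < s" "irreducible p \<and> p dvd G_poly f s r"
    then show "\<not> total_degree p < 2"
      using no_factor_of_total_degree_less_2[OF _ z, of r s p] assms(1) by simp
  next
    fix \<epsilon> :: real assume \<epsilon>: "\<epsilon> > 0"
    have "(\<lambda>N. real (card {(a, h) \<in> {1..int N} \<times> {1..int N}. invisible_along F (a, h)}))
        \<in> O(\<lambda>N. real N * sqrt N + K * real N * sqrt N * (1 + ln (real N))\<^sup>2)"
      using K(2) by (intro bigoI[of _ 1]) (auto elim!: eventually_mono)
    \<comment> \<open>Both terms are N^(3/2) up to a squared logarithm, which N^\<epsilon> absorbs;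
      3/2 is 1 + 1/\<delta> for \<delta> = 2.\<close>
    also have "(\<lambda>N. real N * sqrt N + K * real N * sqrt N * (1 + ln (real N))\<^sup>2)
        \<in> O(\<lambda>N. real N powr (1 + 1 / 2 + \<epsilon>))"
      using \<epsilon> K(1) by real_asymp
    finally show "(\<lambda>N. real (card {(a, h) \<in> {1..int N} \<times> {1..int N}. invisible_along F (a, h)}))
        \<in> O(\<lambda>N. real N powr (1 + 1 / real 2 + \<epsilon>))"
      by simp
  qed simp
qed

end
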